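(* $\mathcal G_0$, equipped with the metric $d$, is a complete metric space.
   Context: Fix a countably infinite vertex set $V=\{v_1,v_2,v_3,\dots\}$ and let $E$ be the set of all 2-element subsets of $V$ (write $uv$ for $\{u,v\}$). A labeled graph is a function $w:E\to\mathbb R$; $W$ is the set (vector space) of all labeled graphs. An edge $e$ is nonzero in $w$ if $w(e)\ne 0$; a vertex is isolated in $w$ if no nonzero edge of $w$ contains it. $w$ is standard if it has infinitely many isolated vertices; $W^s$ is the set of standard labeled graphs. For $w,w'\in W$ put $|w|=\sum_{e\in E}|w(e)|\in[0,\infty]$ and $d(w,w')=|w-w'|$; $W_0=\{w\in W: |w|<\infty\}$ and $W^s_0=W_0\cap W^s$. $w\sim w'$ (isomorphic) means there is a bijection $f:V\to V$ with $w(uv)=w'(f(u)f(v))$ for all $uv\in E$. $\mathcal G_0=W^s_0/\sim$ is the set of unlabeled graphs of finite norm. For $G,G'\in\mathcal G_0$, $d(G,G')=\inf\{d(w,w') : w\in G,\ w'\in G'\}$; this is a metric on $\mathcal G_0$. *)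

theory Defs
  imports "HOL-Analysis.Analysis"
begin

definition edges :: "'v set \<Rightarrow> 'v set set" where
  "edges V = {e. e \<subseteq> V \<and> card e = 2}"

text \<open>
  Functions on the set of edges are represented as extensional functions, so that two
  labeled graphs are equal iff they agree on all edges.
\<close>

definition labeled_graphs :: "'v set \<Rightarrow> ('v set \<Rightarrow> real) set" where
  "labeled_graphs V = (edges V \<rightarrow>\<^sub>E UNIV)"

definition isolated_vertex :: "'v set \<Rightarrow> ('v set \<Rightarrow> real) \<Rightarrow> 'v \<Rightarrow> bool" where
  "isolated_vertex V w v \<longleftrightarrow> v \<in> V \<and> \<not> (\<exists>e\<in>edges V. w e \<noteq> 0 \<and> v \<in> e)"

definition standard_graphs :: "'v set \<Rightarrow> ('v set \<Rightarrow> real) set" where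
  "standard_graphs V = {w \<in> labeled_graphs V. infinite {v. isolated_vertex V w v}}"

text \<open>
  The sum is taken in \<^typ>\<open>ennreal\<close>, where it always converges (possibly to infinity).
\<close>

definition graph_norm :: "'v set \<Rightarrow> ('v set \<Rightarrow> real) \<Rightarrow> ennreal" where
  "graph_norm V w = (\<Sum>\<^sub>\<infinity>e\<in>edges V. ennreal \<bar>w e\<bar>)"

definition labeled_dist :: "'v set \<Rightarrow> ('v set \<Rightarrow> real) \<Rightarrow> ('v set \<Rightarrow> real) \<Rightarrow> ennreal" where
  "labeled_dist V w w' = graph_norm V (\<lambda>e\<in>edges V. w e - w' e)"

definition finite_norm_graphs :: "'v set \<Rightarrow> ('v set \<Rightarrow> real) set" where
  "finite_norm_graphs V = {w \<in> labeled_graphs V. graph_norm V w < \<infinity>}"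

definition finite_norm_standard_graphs :: "'v set \<Rightarrow> ('v set \<Rightarrow> real) set" where
  "finite_norm_standard_graphs V = finite_norm_graphs V \<inter> standard_graphs V"

definition isomorphic_graphs ::
    "'v set \<Rightarrow> ('v set \<Rightarrow> real) \<Rightarrow> ('v set \<Rightarrow> real) \<Rightarrow> bool" where
  "isomorphic_graphs V w w' \<longleftrightarrow>
     (\<exists>f. bij_betw f V V \<and> (\<forall>u\<in>V. \<forall>v\<in>V. u \<noteq> v \<longrightarrow> w {u, v} = w' {f u, f v}))"

definition unlabeled_graphs :: "'v set \<Rightarrow> ('v set \<Rightarrow> real) set set" where
  "unlabeled_graphs V =
     finite_norm_standard_graphs V //
       {(w, w'). w \<in> finite_norm_standard_graphs V \<and> w' \<in> finite_norm_standard_graphs V \<and>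
                 isomorphic_graphs V w w'}"

text \<open>
  On nonempty sets of labeled graphs of finite norm the infimum is finite, so
  \<^const>\<open>enn2real\<close> only changes its type.
\<close>

definition unlabeled_dist ::
    "'v set \<Rightarrow> ('v set \<Rightarrow> real) set \<Rightarrow> ('v set \<Rightarrow> real) set \<Rightarrow> real" where
  "unlabeled_dist V G G' = enn2real (INF w\<in>G. INF w'\<in>G'. labeled_dist V w w')"

end

theory Submission
  imports Defs "HOL-Library.Diagonal_Subsequence"
begin

text \<open>
  Distances are finite because representatives have finite norm, and symmetry is evident. As moving
  the labels by a permutation of the vertices preserves the labeled distance, the distance of two
  classes is already the infimum over representatives of one class against a fixed representative
  of the other (\<open>unlabeled_edist_fixed_representative\<close>). The triangle inequality follows.

  The first difficulty is that distance zero forces isomorphism. Distance zero between the classes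
  of \<open>w\<close> and \<open>w'\<close> gives permutations \<open>f n\<close> with \<open>w e\<close> uniformly close to \<open>w' (f n ` e)\<close>. A graph
  of finite norm has only finitely many edges whose weight exceeds a given positive bound, so a
  nonzero edge of \<open>w\<close> has only finitely many images, and therefore so has each non-isolated vertex.
  A diagonal argument yields a subsequence along which \<open>f n\<close> becomes constant at each non-isolated
  vertex. The limit is an isomorphism between the non-isolated parts of \<open>w\<close> and \<open>w'\<close>. It extends to
  all vertices because both graphs have countably infinitely many isolated vertices
  (\<open>isomorphic_graphs_of_almost_isomorphisms\<close>).

  For completeness, a Cauchy sequence of classes has a subsequence with geometrically decreasing
  steps, and its representatives can be chosen one after the other so that consecutive labeled
  distances decrease geometrically too. They converge in the complete space of labeled graphs of
  finite norm. The second difficulty is that the limit may have no isolated vertex at all. But if all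
  graphs are moved along one injection of the vertex set whose range has infinite complement, then
  distances are preserved, the class of each standard graph is unchanged, and the image of the limit
  is standard (\<open>geometric_Cauchy_unlabeled_limit\<close>).
\<close>

section \<open>The norm of a labeled graph\<close>

lemma graph_norm_le_iff:
  "graph_norm V w \<le> C \<longleftrightarrow> (\<forall>F. finite F \<and> F \<subseteq> edges V \<longrightarrow> (\<Sum>e\<in>F. ennreal \<bar>w e\<bar>) \<le> C)"
  unfolding graph_norm_def by (subst nonneg_infsum_complete) (auto simp: SUP_le_iff)

lemma graph_norm_cong:
  assumes "\<And>e. e \<in> edges V \<Longrightarrow> \<bar>w e\<bar> = \<bar>w' e\<bar>"
  shows "graph_norm V w = graph_norm V w'"
  unfolding graph_norm_def using assms by (intro infsum_cong) simp

lemma graph_norm_triangle: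
  assumes "\<And>e. e \<in> edges V \<Longrightarrow> \<bar>w e\<bar> \<le> \<bar>w1 e\<bar> + \<bar>w2 e\<bar>"
  shows "graph_norm V w \<le> graph_norm V w1 + graph_norm V w2"
proof -
  have "graph_norm V w \<le> (\<Sum>\<^sub>\<infinity>e\<in>edges V. ennreal \<bar>w1 e\<bar> + ennreal \<bar>w2 e\<bar>)"
    unfolding graph_norm_def
    using assms by (intro infsum_mono nonneg_summable_on_complete)
      (auto simp: ennreal_plus[symmetric] simp del: ennreal_plus intro!: ennreal_leI)
  also have "\<dots> = graph_norm V w1 + graph_norm V w2"
    unfolding graph_norm_def by (intro infsum_add nonneg_summable_on_complete) auto
  finally show ?thesis .
qed

lemma ennreal_abs_le_graph_norm:
  assumes "e \<in> edges V"
  shows "ennreal \<bar>w e\<bar> \<le> graph_norm V w"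
proof -
  have "(\<Sum>e\<in>{e}. ennreal \<bar>w e\<bar>) \<le> graph_norm V w"
    using assms graph_norm_le_iff[of V w "graph_norm V w"] by blast
  then show ?thesis by simp
qed

text \<open>Finite norm enters the zero-distance argument only through this property: the weights vanish
  at infinity.\<close>

lemma finite_large_edges:
  assumes "graph_norm V w < \<infinity>" and "0 < a"
  shows "finite {e \<in> edges V. a \<le> \<bar>w e\<bar>}"
proof (rule ccontr)
  let ?B = "{e \<in> edges V. a \<le> \<bar>w e\<bar>}"
  assume inf: "infinite ?B"
  have "((\<lambda>e. ennreal \<bar>w e\<bar>) has_sum \<infinity>) ?B"
    using assms(2) inf
    by (intro has_sum_superconst_infinite_ennreal[where b = "ennreal a"]) (auto intro: ennreal_leI)
  then have "infsum (\<lambda>e. ennreal \<bar>w e\<bar>) ?B = \<infinity>"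
    by (rule infsumI)
  moreover have "infsum (\<lambda>e. ennreal \<bar>w e\<bar>) ?B \<le> graph_norm V w"
    unfolding graph_norm_def
    by (intro infsum_mono_neutral nonneg_summable_on_complete) auto
  ultimately show False
    using assms(1) by (simp add: top_unique)
qed

lemma labeled_dist_eq: "labeled_dist V w w' = graph_norm V (\<lambda>e. w e - w' e)"
  unfolding labeled_dist_def by (rule graph_norm_cong) simp

lemma labeled_dist_commute: "labeled_dist V w w' = labeled_dist V w' w"
  unfolding labeled_dist_eq by (rule graph_norm_cong) simp

lemma labeled_dist_triangle:
  "labeled_dist V w w'' \<le> labeled_dist V w w' + labeled_dist V w' w''"
  unfolding labeled_dist_eq by (rule graph_norm_triangle) simp

lemma labeled_dist_self: "labeled_dist V w w = 0"
  unfolding labeled_dist_eq graph_norm_def by simp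

lemma labeled_dist_le_norms: "labeled_dist V w w' \<le> graph_norm V w + graph_norm V w'"
  unfolding labeled_dist_eq by (rule graph_norm_triangle) simp

lemma abs_diff_le_labeled_dist:
  "e \<in> edges V \<Longrightarrow> ennreal \<bar>w e - w' e\<bar> \<le> labeled_dist V w w'"
  unfolding labeled_dist_eq using ennreal_abs_le_graph_norm[of e V "\<lambda>e. w e - w' e"] by simp

text \<open>Completeness of the labeled graphs of finite norm, which form an \<open>\<ell>\<^sup>1\<close> space: the
  pointwise limit is the limit in norm because the norm is a supremum of finite partial sums.\<close>

lemma geometric_Cauchy_labeled_limit:
  assumes fin: "\<And>n. w n \<in> finite_norm_graphs V"
    and step: "\<And>n. labeled_dist V (w n) (w (Suc n)) \<le> ennreal ((1/2)^n)"
  shows "\<exists>l\<in>finite_norm_graphs V. \<forall>n. labeled_dist V (w n) l \<le> ennreal (2 * (1/2)^n)"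
proof -
  \<comment> \<open>The factor 2 is the sum of the geometric series; splitting off the first step keeps the bound
    independent of \<open>k\<close>.\<close>
  have tail: "labeled_dist V (w n) (w (n + k)) \<le> ennreal (2 * (1/2)^n)" for n k
  proof (induction k arbitrary: n)
    case 0
    then show ?case by (simp add: labeled_dist_self)
  next
    case (Suc k)
    have "labeled_dist V (w n) (w (Suc n + k))
        \<le> labeled_dist V (w n) (w (Suc n)) + labeled_dist V (w (Suc n)) (w (Suc n + k))"
      by (rule labeled_dist_triangle)
    also have "\<dots> \<le> ennreal ((1/2)^n) + ennreal (2 * (1/2)^(Suc n))"
      by (intro add_mono step Suc.IH)
    also have "\<dots> = ennreal (2 * (1/2)^n)"
      by (subst ennreal_plus[symmetric]) auto
    finally show ?case by simp
  qed
  have ptw: "\<bar>w n e - w (n + k) e\<bar> \<le> 2 * (1/2)^n" if "e \<in> edges V" for n k e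
    using order_trans[OF abs_diff_le_labeled_dist[OF that] tail[of n k]]
    by (subst (asm) ennreal_le_iff) auto
  have conv: "convergent (\<lambda>n. w n e)" if e: "e \<in> edges V" for e
  proof (rule Cauchy_convergent, rule metric_CauchyI)
    fix r :: real
    assume "0 < r"
    then obtain N where N: "(1/2)^N < r/4"
      using real_arch_pow_inv[of "r/4" "1/2"] by auto
    have "dist (w m e) (w n e) < r" if "N \<le> m" "N \<le> n" for m n
      using ptw[OF e, of N "m - N"] ptw[OF e, of N "n - N"] that N
      by (simp add: dist_real_def)
    then show "\<exists>M. \<forall>m\<ge>M. \<forall>n\<ge>M. dist (w m e) (w n e) < r"
      by blast
  qed
  define l where "l = (\<lambda>e\<in>edges V. lim (\<lambda>n. w n e))"
  have lim: "(\<lambda>n. w n e) \<longlonglongrightarrow> l e" if "e \<in> edges V" for e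
    using conv[OF that] that by (simp add: l_def convergent_LIMSEQ_iff)
  have near: "labeled_dist V (w n) l \<le> ennreal (2 * (1/2)^n)" for n
    unfolding labeled_dist_eq graph_norm_le_iff
  proof (intro allI impI, elim conjE)
    fix F
    assume F: "finite F" "F \<subseteq> edges V"
    have "(\<lambda>k. \<Sum>e\<in>F. \<bar>w n e - w (k + n) e\<bar>) \<longlonglongrightarrow> (\<Sum>e\<in>F. \<bar>w n e - l e\<bar>)"
      using F by (intro tendsto_sum tendsto_rabs tendsto_diff tendsto_const LIMSEQ_ignore_initial_segment lim) auto
    moreover have "(\<Sum>e\<in>F. \<bar>w n e - w (k + n) e\<bar>) \<le> 2 * (1/2)^n" for k
    proof -
      have "ennreal (\<Sum>e\<in>F. \<bar>w n e - w (k + n) e\<bar>) = (\<Sum>e\<in>F. ennreal \<bar>w n e - w (k + n) e\<bar>)"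
        by simp
      also have "\<dots> \<le> ennreal (2 * (1/2)^n)"
        using tail[of n k] F unfolding labeled_dist_eq graph_norm_le_iff by (simp add: add.commute)
      finally show ?thesis
        by (subst (asm) ennreal_le_iff) auto
    qed
    ultimately have "(\<Sum>e\<in>F. \<bar>w n e - l e\<bar>) \<le> 2 * (1/2)^n"
      by (intro LIMSEQ_le_const2) auto
    then show "(\<Sum>e\<in>F. ennreal \<bar>w n e - l e\<bar>) \<le> ennreal (2 * (1/2)^n)"
      by (subst sum_ennreal) (auto intro: ennreal_leI)
  qed
  have "graph_norm V l \<le> graph_norm V (w 0) + labeled_dist V (w 0) l"
    unfolding labeled_dist_eq by (rule graph_norm_triangle) simp
  also have "\<dots> < \<infinity>"
    using fin[of 0] near[of 0] by (auto simp: finite_norm_graphs_def le_less_trans)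
  finally have "l \<in> finite_norm_graphs V"
    by (auto simp: finite_norm_graphs_def labeled_graphs_def l_def)
  with near show ?thesis by blast
qed

section \<open>Moving labels along injections of the vertex set\<close>

text \<open>Extension by zero makes this meaningful for injections that are not surjective: the vertices
  outside the range become isolated.\<close>

definition push :: "'v set \<Rightarrow> ('v \<Rightarrow> 'v) \<Rightarrow> ('v set \<Rightarrow> real) \<Rightarrow> 'v set \<Rightarrow> real" where
  "push V f w = (\<lambda>e\<in>edges V. if e \<subseteq> f ` V then w (inv_into V f ` e) else 0)"

lemma edges_image:
  assumes "inj_on f V" "f ` V \<subseteq> V" "e \<in> edges V"
  shows "f ` e \<in> edges V"
  using assms by (auto simp: edges_def card_image inj_on_subset)

lemma edges_preimage:
  assumes "inj_on f V" "e \<in> edges V" "e \<subseteq> f ` V"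
  obtains e' where "e' \<in> edges V" "e = f ` e'"
proof -
  obtain e' where e': "e' \<subseteq> V" "e = f ` e'"
    using assms(3) by (auto simp: subset_image_iff)
  then have "card e' = 2"
    using assms(1,2) by (auto simp: edges_def card_image inj_on_subset)
  with e' that show thesis by (auto simp: edges_def)
qed

lemma push_image:
  assumes "inj_on f V" "f ` V \<subseteq> V" "e \<in> edges V"
  shows "push V f w (f ` e) = w e"
proof -
  have "inv_into V f ` f ` e = e"
    using assms by (intro inv_into_image_cancel) (auto simp: edges_def)
  moreover have "e \<subseteq> V"
    using assms by (auto simp: edges_def)
  ultimately show ?thesis
    using edges_image[OF assms] by (auto simp: push_def)
qed

lemma push_outside: "e \<in> edges V \<Longrightarrow> \<not> e \<subseteq> f ` V \<Longrightarrow> push V f w e = 0"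
  by (simp add: push_def)

lemma push_in_labeled_graphs: "push V f w \<in> labeled_graphs V"
  by (simp add: push_def labeled_graphs_def)

text \<open>The map \<open>f\<close> induces an injection on edges, and all edges outside its range get weight 0, so
  the sums have the same nonzero terms.\<close>

lemma graph_norm_push:
  assumes "inj_on f V" "f ` V \<subseteq> V"
  shows "graph_norm V (push V f w) = graph_norm V w"
proof -
  have inj: "inj_on ((`) f) (edges V)"
    by (rule inj_on_subset[OF inj_on_image_Pow[OF assms(1)]]) (auto simp: edges_def)
  have zero: "push V f w e = 0" if "e \<in> edges V - (`) f ` edges V" for e
    using that edges_preimage[OF assms(1), of e] by (intro push_outside) auto
  have "graph_norm V (push V f w) = (\<Sum>\<^sub>\<infinity>e\<in>(`) f ` edges V. ennreal \<bar>push V f w e\<bar>)"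
    unfolding graph_norm_def using edges_image[OF assms] zero
    by (intro infsum_cong_neutral) auto
  also have "\<dots> = (\<Sum>\<^sub>\<infinity>e\<in>edges V. ennreal \<bar>push V f w (f ` e)\<bar>)"
    by (subst infsum_reindex[OF inj]) (simp add: o_def)
  also have "\<dots> = graph_norm V w"
    unfolding graph_norm_def by (intro infsum_cong) (simp add: push_image[OF assms])
  finally show ?thesis .
qed

lemma labeled_dist_push:
  assumes "inj_on f V" "f ` V \<subseteq> V"
  shows "labeled_dist V (push V f w) (push V f w') = labeled_dist V w w'"
proof -
  have "labeled_dist V (push V f w) (push V f w') = graph_norm V (push V f (\<lambda>e. w e - w' e))"
    unfolding labeled_dist_eq by (rule graph_norm_cong) (simp add: push_def)
  then show ?thesis
    by (simp add: graph_norm_push[OF assms] labeled_dist_eq)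
qed

lemma push_in_finite_norm_graphs:
  assumes "inj_on f V" "f ` V \<subseteq> V" "w \<in> finite_norm_graphs V"
  shows "push V f w \<in> finite_norm_graphs V"
  using assms by (simp add: finite_norm_graphs_def push_in_labeled_graphs graph_norm_push)

section \<open>Isomorphism\<close>

lemma isomorphic_graphs_iff_edges:
  "isomorphic_graphs V w w' \<longleftrightarrow> (\<exists>f. bij_betw f V V \<and> (\<forall>e\<in>edges V. w e = w' (f ` e)))"
proof -
  have "(\<forall>u\<in>V. \<forall>v\<in>V. u \<noteq> v \<longrightarrow> w {u, v} = w' {f u, f v}) \<longleftrightarrow> (\<forall>e\<in>edges V. w e = w' (f ` e))"
    (is "?L \<longleftrightarrow> ?R") for f
  proof
    assume L: ?L
    show ?R
    proof
      fix e
      assume "e \<in> edges V"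
      then obtain u v where "u \<in> V" "v \<in> V" "u \<noteq> v" "e = {u, v}"
        unfolding edges_def card_2_iff by blast
      then show "w e = w' (f ` e)"
        using L by simp
    qed
  next
    assume R: ?R
    show ?L
    proof (intro ballI impI)
      fix u v
      assume "u \<in> V" "v \<in> V" "u \<noteq> v"
      then have "{u, v} \<in> edges V"
        by (simp add: edges_def)
      then have "w {u, v} = w' (f ` {u, v})"
        using R by blast
      then show "w {u, v} = w' {f u, f v}"
        by simp
    qed
  qed
  then show ?thesis
    by (simp add: isomorphic_graphs_def)
qed

lemma isomorphic_graphs_iff_push:
  assumes "w' \<in> labeled_graphs V"
  shows "isomorphic_graphs V w w' \<longleftrightarrow> (\<exists>f. bij_betw f V V \<and> w' = push V f w)"
  unfolding isomorphic_graphs_iff_edges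
proof (rule iff_exI, rule conj_cong[OF refl])
  fix f
  assume "bij_betw f V V"
  then have f: "inj_on f V" "f ` V = V"
    by (auto simp: bij_betw_def)
  show "(\<forall>e\<in>edges V. w e = w' (f ` e)) \<longleftrightarrow> w' = push V f w"
  proof
    assume *: "\<forall>e\<in>edges V. w e = w' (f ` e)"
    show "w' = push V f w"
    proof (rule PiE_ext)
      show "w' \<in> edges V \<rightarrow>\<^sub>E UNIV" "push V f w \<in> edges V \<rightarrow>\<^sub>E UNIV"
        using assms push_in_labeled_graphs[of V f w] by (simp_all add: labeled_graphs_def)
      fix e
      assume "e \<in> edges V"
      moreover have "e \<subseteq> f ` V"
        using \<open>e \<in> edges V\<close> f by (auto simp: edges_def)
      ultimately obtain e' where "e' \<in> edges V" "e = f ` e'"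
        using edges_preimage[OF f(1)] by metis
      then show "w' e = push V f w e"
        using * f by (simp add: push_image)
    qed
  next
    assume "w' = push V f w"
    then show "\<forall>e\<in>edges V. w e = w' (f ` e)"
      using f by (simp add: push_image)
  qed
qed

lemma isomorphic_graphs_refl: "isomorphic_graphs V w w"
  unfolding isomorphic_graphs_iff_edges by (rule exI[of _ id]) simp

lemma isomorphic_graphs_sym:
  assumes "isomorphic_graphs V w w'"
  shows "isomorphic_graphs V w' w"
proof -
  obtain f where f: "bij_betw f V V" and w: "\<forall>e\<in>edges V. w e = w' (f ` e)"
    using assms unfolding isomorphic_graphs_iff_edges by blast
  have inv: "bij_betw (inv_into V f) V V"
    using f by (rule bij_betw_inv_into)
  have "w' e = w (inv_into V f ` e)" if e: "e \<in> edges V" for e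
  proof -
    have "inv_into V f ` e \<in> edges V"
      using e inv by (intro edges_image) (auto simp: bij_betw_def)
    moreover have "f ` inv_into V f ` e = e"
      using f e by (intro image_inv_into_cancel[of f V V]) (auto simp: bij_betw_def edges_def)
    ultimately show ?thesis
      using w by simp
  qed
  with inv show ?thesis
    unfolding isomorphic_graphs_iff_edges by blast
qed

lemma isomorphic_graphs_trans:
  assumes "isomorphic_graphs V w w'" "isomorphic_graphs V w' w''"
  shows "isomorphic_graphs V w w''"
proof -
  obtain f g where f: "bij_betw f V V" "\<forall>e\<in>edges V. w e = w' (f ` e)"
    and g: "bij_betw g V V" "\<forall>e\<in>edges V. w' e = w'' (g ` e)"
    using assms unfolding isomorphic_graphs_iff_edges by blast
  have "\<forall>e\<in>edges V. w e = w'' ((g \<circ> f) ` e)"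
    unfolding image_comp[symmetric] using f g edges_image[of f V] by (auto simp: bij_betw_def)
  then show ?thesis
    unfolding isomorphic_graphs_iff_edges using bij_betw_trans[OF f(1) g(1)] by blast
qed

definition active_vertices :: "'v set \<Rightarrow> ('v set \<Rightarrow> real) \<Rightarrow> 'v set" where
  "active_vertices V w = {v. \<exists>e\<in>edges V. w e \<noteq> 0 \<and> v \<in> e}"

lemma active_vertices_subset: "active_vertices V w \<subseteq> V"
  by (auto simp: active_vertices_def edges_def)

lemma isolated_eq_diff_active: "{v. isolated_vertex V w v} = V - active_vertices V w"
  by (auto simp: active_vertices_def isolated_vertex_def)

lemma standard_graphs_iff:
  "w \<in> standard_graphs V \<longleftrightarrow> w \<in> labeled_graphs V \<and> infinite (V - active_vertices V w)"
  by (simp add: standard_graphs_def isolated_eq_diff_active)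

lemma nonzero_edge_active: "e \<in> edges V \<Longrightarrow> w e \<noteq> 0 \<Longrightarrow> e \<subseteq> active_vertices V w"
  by (auto simp: active_vertices_def)

text \<open>Only the non-isolated vertices matter for standard graphs: the two sets of isolated vertices are
  countably infinite, so any bijection between them completes \<open>g\<close> to a permutation, and every edge
  that meets them has weight 0.\<close>

lemma isomorphic_graphs_of_active_bij:
  assumes V: "countable V"
    and w: "w \<in> standard_graphs V" and w': "w' \<in> standard_graphs V"
    and g: "bij_betw g (active_vertices V w) (active_vertices V w')"
    and wg: "\<And>e. e \<in> edges V \<Longrightarrow> e \<subseteq> active_vertices V w \<Longrightarrow> w e = w' (g ` e)"
  shows "isomorphic_graphs V w w'"
proof -
  let ?S = "active_vertices V w" and ?S' = "active_vertices V w'"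
  have "infinite (V - ?S)" "infinite (V - ?S')" "countable (V - ?S)" "countable (V - ?S')"
    using w w' V by (auto simp: standard_graphs_iff)
  then obtain h where h: "bij_betw h (V - ?S) (V - ?S')"
    by (meson bij_betw_trans bij_betw_inv_into to_nat_on_infinite)
  define f where "f v = (if v \<in> ?S then g v else h v)" for v
  have fS: "bij_betw f ?S ?S'" "bij_betw f (V - ?S) (V - ?S')"
    using g h bij_betw_cong[of ?S f g ?S'] bij_betw_cong[of "V - ?S" f h "V - ?S'"]
    by (simp_all add: f_def)
  have f: "bij_betw f V V"
    using bij_betw_combine[OF fS] active_vertices_subset[of V w] active_vertices_subset[of V w']
    by (simp add: Un_absorb1)
  have "w e = w' (f ` e)" if e: "e \<in> edges V" for e
  proof (cases "e \<subseteq> ?S")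
    case True
    then have "f ` e = g ` e"
      by (intro image_cong) (auto simp: f_def)
    with wg[OF e True] show ?thesis by simp
  next
    case False
    then obtain v where v: "v \<in> e" "v \<in> V - ?S"
      using e by (auto simp: edges_def)
    then have "f v \<in> V - ?S'"
      using fS(2) by (auto simp: bij_betw_def)
    then have "\<not> f ` e \<subseteq> ?S'"
      using v(1) by auto
    moreover have "f ` e \<in> edges V"
      using f e by (intro edges_image) (auto simp: bij_betw_def)
    ultimately show ?thesis
      using False e nonzero_edge_active[of _ V] by metis
  qed
  with f show ?thesis
    unfolding isomorphic_graphs_iff_edges by blast
qed

lemma active_vertices_push:
  assumes "inj_on f V" "f ` V \<subseteq> V"
  shows "active_vertices V (push V f w) = f ` active_vertices V w"
proof (intro equalityI subsetI)
  fix v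
  assume "v \<in> active_vertices V (push V f w)"
  then obtain e where e: "e \<in> edges V" "push V f w e \<noteq> 0" "v \<in> e"
    by (auto simp: active_vertices_def)
  then obtain e' where "e' \<in> edges V" "e = f ` e'"
    using push_outside edges_preimage[OF assms(1)] by metis
  with e show "v \<in> f ` active_vertices V w"
    by (auto simp: push_image[OF assms] active_vertices_def)
next
  fix v
  assume "v \<in> f ` active_vertices V w"
  then obtain e where e: "e \<in> edges V" "w e \<noteq> 0" "v \<in> f ` e"
    by (auto simp: active_vertices_def)
  then show "v \<in> active_vertices V (push V f w)"
    using nonzero_edge_active[OF edges_image[OF assms e(1)], of "push V f w"]
    by (auto simp: push_image[OF assms e(1)])
qed

lemma push_standard:
  assumes "inj_on f V" "f ` V \<subseteq> V" "w \<in> standard_graphs V"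
  shows "push V f w \<in> standard_graphs V"
proof -
  have "f ` (V - active_vertices V w) \<subseteq> V - active_vertices V (push V f w)"
    using assms(2) inj_onD[OF assms(1)] active_vertices_subset[of V w]
    by (fastforce simp: active_vertices_push[OF assms(1,2)])
  moreover have "infinite (f ` (V - active_vertices V w))"
    using assms by (simp add: standard_graphs_iff finite_image_iff inj_on_subset)
  ultimately show ?thesis
    by (auto simp: standard_graphs_iff push_in_labeled_graphs dest: finite_subset)
qed

text \<open>This is what makes the limit of a Cauchy sequence standard: \<open>w\<close> itself may have no isolated
  vertices.\<close>

lemma push_coinfinite_standard:
  assumes "inj_on f V" "f ` V \<subseteq> V" "infinite (V - f ` V)"
  shows "push V f w \<in> standard_graphs V"
proof -
  have "V - f ` V \<subseteq> V - active_vertices V (push V f w)"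
    using active_vertices_subset[of V w] by (auto simp: active_vertices_push[OF assms(1,2)])
  then show ?thesis
    using assms(3) by (auto simp: standard_graphs_iff push_in_labeled_graphs dest: finite_subset)
qed

text \<open>A standard graph has enough isolated vertices to absorb those that a non-surjective \<open>f\<close> adds, so
  its class does not change.\<close>

lemma isomorphic_graphs_push:
  assumes "countable V" "inj_on f V" "f ` V \<subseteq> V" "w \<in> standard_graphs V"
  shows "isomorphic_graphs V w (push V f w)"
proof (rule isomorphic_graphs_of_active_bij[OF assms(1,4) push_standard[OF assms(2-4)]])
  show "bij_betw f (active_vertices V w) (active_vertices V (push V f w))"
    using assms active_vertices_subset[of V w]
    by (simp add: active_vertices_push bij_betw_imageI inj_on_subset)
qed (simp add: push_image[OF assms(2,3)])

section \<open>Limits of almost isomorphisms\<close>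

text \<open>Sequential compactness of a countable product of finite discrete spaces, by a diagonal
  sequence.\<close>

lemma eventually_constant_subseq:
  fixes f :: "nat \<Rightarrow> 'a \<Rightarrow> 'b"
  assumes "countable S" and fin: "\<And>u. u \<in> S \<Longrightarrow> finite (range (\<lambda>n. f n u))"
  obtains s g where "strict_mono s" "\<And>u. u \<in> S \<Longrightarrow> \<forall>\<^sub>F n in sequentially. f (s n) u = g u"
proof -
  define P where "P k s \<longleftrightarrow> (from_nat_into S k \<in> S \<longrightarrow>
      (\<exists>c. \<forall>\<^sub>F n in sequentially. f (s n) (from_nat_into S k) = c))" for k and s :: "nat \<Rightarrow> nat"
  interpret subseqs P
  proof
    fix k and s :: "nat \<Rightarrow> nat"
    show "\<exists>r. strict_mono r \<and> P k (s \<circ> r)"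
    proof (cases "from_nat_into S k \<in> S")
      case False
      then show ?thesis
        using strict_mono_id by (auto simp: P_def)
    next
      case True
      let ?h = "\<lambda>n. f (s n) (from_nat_into S k)"
      have "finite (range ?h)"
        by (rule finite_subset[OF _ fin[OF True]]) auto
      then obtain n where "infinite {m. ?h m = ?h n}"
        using pigeonhole_infinite[of UNIV ?h] by auto
      then obtain r :: "nat \<Rightarrow> nat" where "strict_mono r" "\<And>m. r m \<in> {m. ?h m = ?h n}"
        using infinite_enumerate by blast
      then show ?thesis
        by (auto simp: P_def)
    qed
  qed
  have stable: "P k (s \<circ> r)" if "strict_mono r" "P k s" for r s k
    using that eventually_subseq[OF that(1)] unfolding P_def o_def by fast
  have "\<exists>c. \<forall>\<^sub>F n in sequentially. f (diagseq n) u = c" if u: "u \<in> S" for u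
  proof -
    obtain k where k: "u = from_nat_into S k"
      using from_nat_into_surj[OF \<open>countable S\<close> u] by metis
    then obtain c where "\<forall>\<^sub>F n in sequentially. f (diagseq (Suc k + n)) u = c"
      using diagseq_holds[of k, OF stable] u by (auto simp: P_def)
    then show ?thesis
      using eventually_sequentially_seg[of "\<lambda>n. f (diagseq n) u = c" "Suc k"]
      by (auto simp: add.commute)
  qed
  then obtain g where "\<forall>\<^sub>F n in sequentially. f (diagseq n) u = g u" if "u \<in> S" for u
    by metis
  then show thesis
    using that subseq_diagseq by blast
qed

text \<open>The permutations \<open>f n\<close> need not converge on isolated vertices, but on a non-isolated vertex they
  take finitely many values: it lies on an edge \<open>e\<close> with \<open>w e \<noteq> 0\<close>, and for large \<open>n\<close> the edge
  \<open>f n ` e\<close> is among the finitely many edges of \<open>w'\<close> of weight at least half of \<open>\<bar>w e\<bar>\<close>. So a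
  subsequence converges to some \<open>g\<close> on the non-isolated vertices, and \<open>g\<close> preserves weights exactly.
  It reaches every nonzero edge of \<open>w'\<close> by the same finiteness applied to the preimages of that edge.\<close>

lemma isomorphic_graphs_of_almost_isomorphisms:
  assumes V: "countable V"
    and w: "w \<in> finite_norm_standard_graphs V" and w': "w' \<in> finite_norm_standard_graphs V"
    and f: "\<And>n. bij_betw (f n) V V"
    and close: "\<And>n e. e \<in> edges V \<Longrightarrow> \<bar>w e - w' (f n ` e)\<bar> \<le> \<epsilon> n"
    and \<epsilon>: "\<epsilon> \<longlonglongrightarrow> 0"
  shows "isomorphic_graphs V w w'"
proof -
  let ?S = "active_vertices V w" and ?S' = "active_vertices V w'"
  have fin: "finite {e \<in> edges V. a \<le> \<bar>w e\<bar>}" "finite {e \<in> edges V. a \<le> \<bar>w' e\<bar>}" if "0 < a" for a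
    using w w' that
    by (auto simp: finite_norm_standard_graphs_def finite_norm_graphs_def intro!: finite_large_edges)
  have f_edge: "f n ` e \<in> edges V" if "e \<in> edges V" for n e
    using f[of n] that by (intro edges_image) (auto simp: bij_betw_def)
  have edge_sub: "e \<subseteq> V" "finite e" if "e \<in> edges V" for e
    using that by (auto simp: edges_def intro: card_ge_0_finite)
  have "finite (range (\<lambda>n. f n u))" if u: "u \<in> ?S" for u
  proof -
    obtain e where e: "e \<in> edges V" "w e \<noteq> 0" "u \<in> e"
      using u by (auto simp: active_vertices_def)
    define B where "B = {e' \<in> edges V. \<bar>w e\<bar> / 2 \<le> \<bar>w' e'\<bar>}"
    have "finite B"
      unfolding B_def using e by (intro fin) simp
    then have "finite (\<Union>B)"
      using edge_sub by (auto simp: B_def)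
    obtain N where N: "\<And>n. N \<le> n \<Longrightarrow> \<epsilon> n < \<bar>w e\<bar> / 2"
      using order_tendstoD(2)[OF \<epsilon>, of "\<bar>w e\<bar> / 2"] e(2)
      by (auto simp: eventually_sequentially)
    have "f n u \<in> \<Union>B" if "N \<le> n" for n
    proof -
      have "\<bar>w e\<bar> / 2 \<le> \<bar>w' (f n ` e)\<bar>"
        using close[OF e(1), of n] N[OF that] by linarith
      then show ?thesis
        using f_edge[OF e(1)] e(3) by (auto simp: B_def)
    qed
    then have "range (\<lambda>n. f n u) \<subseteq> (\<lambda>n. f n u) ` {..<N} \<union> \<Union>B"
      by (metis (mono_tags, lifting) UnI1 UnI2 image_eqI image_subsetI lessThan_iff linorder_not_less)
    then show ?thesis
      using \<open>finite (\<Union>B)\<close> by (auto intro: finite_subset)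
  qed
  moreover have "countable ?S"
    by (rule countable_subset[OF active_vertices_subset V])
  ultimately obtain s g where s: "strict_mono s"
    and g: "\<And>u. u \<in> ?S \<Longrightarrow> \<forall>\<^sub>F n in sequentially. f (s n) u = g u"
    using eventually_constant_subseq[of ?S f] by blast
  have g_edge: "\<forall>\<^sub>F n in sequentially. f (s n) ` e = g ` e" if e: "e \<subseteq> ?S" "finite e" for e
  proof -
    have "\<forall>\<^sub>F n in sequentially. \<forall>u\<in>e. f (s n) u = g u"
      using e g by (intro eventually_ball_finite) auto
    then show ?thesis
      by eventually_elim (rule image_cong, auto)
  qed
  have \<epsilon>s: "(\<lambda>n. \<epsilon> (s n)) \<longlonglongrightarrow> 0"
    using LIMSEQ_subseq_LIMSEQ[OF \<epsilon> s] by (simp add: o_def)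
  have g_preserves: "w e = w' (g ` e)" if e: "e \<in> edges V" "e \<subseteq> ?S" for e
  proof -
    have "\<forall>\<^sub>F n in sequentially. \<bar>w e - w' (g ` e)\<bar> \<le> \<epsilon> (s n)"
      using g_edge[OF e(2) edge_sub(2)[OF e(1)]]
      by eventually_elim (use close[OF e(1)] in metis)
    then have "\<bar>w e - w' (g ` e)\<bar> \<le> 0"
      by (intro tendsto_lowerbound[OF \<epsilon>s]) auto
    then show ?thesis by simp
  qed
  have g_edges: "g ` e \<in> edges V" if e: "e \<in> edges V" "e \<subseteq> ?S" for e
  proof -
    obtain n where "f (s n) ` e = g ` e"
      using eventually_happens'[OF _ g_edge[OF e(2) edge_sub(2)[OF e(1)]]] by auto
    then show ?thesis
      using f_edge[OF e(1), of "s n"] by simp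
  qed
  have "inj_on g ?S"
  proof (rule inj_onI)
    fix u v
    assume uv: "u \<in> ?S" "v \<in> ?S" "g u = g v"
    have "\<forall>\<^sub>F n in sequentially. f (s n) u = f (s n) v"
      using g[OF uv(1)] g[OF uv(2)] by eventually_elim (simp add: uv(3))
    then obtain n where "f (s n) u = f (s n) v"
      using eventually_happens' by force
    then show "u = v"
      using f[of "s n"] uv active_vertices_subset[of V w] by (auto simp: bij_betw_def dest: inj_onD)
  qed
  moreover have "g ` ?S \<subseteq> ?S'"
  proof (rule image_subsetI)
    fix u
    assume "u \<in> ?S"
    then obtain e where e: "e \<in> edges V" "w e \<noteq> 0" "u \<in> e"
      by (auto simp: active_vertices_def)
    have "e \<subseteq> ?S"
      using e nonzero_edge_active[of e V w] by blast
    then show "g u \<in> ?S'"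
      using e nonzero_edge_active[of "g ` e" V w'] g_edges[of e] g_preserves[of e] by auto
  qed
  \<comment> \<open>A nonzero edge \<open>e'\<close> of \<open>w'\<close> has a preimage under each \<open>f (s n)\<close>, and finitely many of these occur
    for large \<open>n\<close>. One that recurs infinitely often is mapped to \<open>e'\<close> by the limit as well.\<close>
  moreover have "?S' \<subseteq> g ` ?S"
  proof
    fix v
    assume "v \<in> ?S'"
    then obtain e' where e': "e' \<in> edges V" "w' e' \<noteq> 0" "v \<in> e'"
      by (auto simp: active_vertices_def)
    define p where "p n = inv_into V (f (s n)) ` e'" for n
    have p_edge: "p n \<in> edges V" for n
      unfolding p_def using e'(1) bij_betw_inv_into[OF f[of "s n"]]
      by (intro edges_image) (auto simp: bij_betw_def)
    have f_p: "f (s n) ` p n = e'" for n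
      unfolding p_def using f[of "s n"] edge_sub(1)[OF e'(1)]
      by (intro image_inv_into_cancel[of _ V V]) (auto simp: bij_betw_def)
    define B where "B = {e \<in> edges V. \<bar>w' e'\<bar> / 2 \<le> \<bar>w e\<bar>}"
    have finB: "finite B"
      unfolding B_def using e' by (intro fin) simp
    obtain N where N: "\<And>n. N \<le> n \<Longrightarrow> \<epsilon> (s n) < \<bar>w' e'\<bar> / 2"
      using order_tendstoD(2)[OF \<epsilon>s, of "\<bar>w' e'\<bar> / 2"] e'(2)
      by (auto simp: eventually_sequentially)
    have "p n \<in> B" if "N \<le> n" for n
    proof -
      have "\<bar>w' e'\<bar> / 2 \<le> \<bar>w (p n)\<bar>"
        using close[OF p_edge[of n], of "s n"] N[OF that] unfolding f_p by linarith
      then show ?thesis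
        using p_edge by (simp add: B_def)
    qed
    then have "p ` {N..} \<subseteq> B" by auto
    then have "finite (p ` {N..})"
      using finB finite_subset by blast
    then obtain n0 where n0: "N \<le> n0" and inf: "infinite {n \<in> {N..}. p n = p n0}"
      using pigeonhole_infinite[of "{N..}" p] infinite_Ici[of N] by auto
    have "p n0 \<in> B"
      using \<open>p ` {N..} \<subseteq> B\<close> n0 by auto
    then have "w (p n0) \<noteq> 0"
      using e'(2) by (auto simp: B_def)
    then have p0: "p n0 \<in> edges V" "p n0 \<subseteq> ?S"
      using p_edge nonzero_edge_active by blast+
    then obtain M where M: "\<And>n. M \<le> n \<Longrightarrow> f (s n) ` p n0 = g ` p n0"
      using g_edge[of "p n0"] edge_sub by (auto simp: eventually_sequentially)
    obtain n where "M \<le> n" "p n = p n0"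
      using inf unfolding infinite_nat_iff_unbounded_le by blast
    then have "e' = g ` p n0"
      using M[of n] f_p[of n] by simp
    then show "v \<in> g ` ?S"
      using e'(3) p0 by auto
  qed
  ultimately have "bij_betw g ?S ?S'"
    by (auto simp: bij_betw_def)
  then show ?thesis
    using w w' g_preserves
    by (intro isomorphic_graphs_of_active_bij[OF V]) (auto simp: finite_norm_standard_graphs_def)
qed

section \<open>The metric\<close>

abbreviation isomorphism_rel :: "'v set \<Rightarrow> (('v set \<Rightarrow> real) \<times> ('v set \<Rightarrow> real)) set" where
  "isomorphism_rel V \<equiv> {(w, w'). w \<in> finite_norm_standard_graphs V \<and>
     w' \<in> finite_norm_standard_graphs V \<and> isomorphic_graphs V w w'}"

lemma equiv_isomorphism_rel: "equiv (finite_norm_standard_graphs V) (isomorphism_rel V)"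
  by (rule equivI)
    (auto simp: refl_on_def sym_def trans_def intro: isomorphic_graphs_refl isomorphic_graphs_sym
      isomorphic_graphs_trans)

lemma isomorphism_class_in_unlabeled_graphs:
  "w \<in> finite_norm_standard_graphs V \<Longrightarrow> isomorphism_rel V `` {w} \<in> unlabeled_graphs V"
  unfolding unlabeled_graphs_def by (rule quotientI)

lemma unlabeled_graphs_nonempty: "G \<in> unlabeled_graphs V \<Longrightarrow> \<exists>w. w \<in> G"
  unfolding unlabeled_graphs_def using in_quotient_imp_non_empty[OF equiv_isomorphism_rel] by blast

lemma unlabeled_graphs_finite_norm_standard:
  "G \<in> unlabeled_graphs V \<Longrightarrow> w \<in> G \<Longrightarrow> w \<in> finite_norm_standard_graphs V"
  unfolding unlabeled_graphs_def using in_quotient_imp_subset[OF equiv_isomorphism_rel] by blast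

lemma unlabeled_graphs_isomorphic:
  "G \<in> unlabeled_graphs V \<Longrightarrow> w \<in> G \<Longrightarrow> w' \<in> G \<Longrightarrow> isomorphic_graphs V w w'"
  unfolding unlabeled_graphs_def using in_quotient_imp_in_rel[OF equiv_isomorphism_rel, of G V w w'] by blast

lemma unlabeled_graphs_closed:
  assumes "G \<in> unlabeled_graphs V" "w \<in> G" "w' \<in> finite_norm_standard_graphs V"
    "isomorphic_graphs V w w'"
  shows "w' \<in> G"
  using assms in_quotient_imp_closed[OF equiv_isomorphism_rel, of G V w w']
    unlabeled_graphs_finite_norm_standard[of G V w]
  by (simp add: unlabeled_graphs_def)

lemma unlabeled_graphs_eq:
  assumes "G \<in> unlabeled_graphs V" "G' \<in> unlabeled_graphs V" "w \<in> G" "w' \<in> G'"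
    "isomorphic_graphs V w w'"
  shows "G = G'"
proof -
  have "w' \<in> G"
    using assms unlabeled_graphs_closed unlabeled_graphs_finite_norm_standard by metis
  then show ?thesis
    using assms quotient_disj[OF equiv_isomorphism_rel, of G V G'] by (auto simp: unlabeled_graphs_def)
qed

text \<open>Taking values in \<^typ>\<open>ennreal\<close> frees the infima from boundedness conditions.\<close>

definition unlabeled_edist ::
    "'v set \<Rightarrow> ('v set \<Rightarrow> real) set \<Rightarrow> ('v set \<Rightarrow> real) set \<Rightarrow> ennreal" where
  "unlabeled_edist V G G' = (INF w\<in>G. INF w'\<in>G'. labeled_dist V w w')"

lemma unlabeled_dist_eq: "unlabeled_dist V G G' = enn2real (unlabeled_edist V G G')"
  by (simp add: unlabeled_dist_def unlabeled_edist_def)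

lemma unlabeled_edist_le:
  "w \<in> G \<Longrightarrow> w' \<in> G' \<Longrightarrow> unlabeled_edist V G G' \<le> labeled_dist V w w'"
  unfolding unlabeled_edist_def by (meson INF_lower2 order_refl)

lemma unlabeled_edist_commute: "unlabeled_edist V G G' = unlabeled_edist V G' G"
  unfolding unlabeled_edist_def by (subst INF_commute) (simp add: labeled_dist_commute)

text \<open>A permutation that carries \<open>w1\<close> to \<open>w\<close> carries any pair \<open>(w1, w1')\<close> of representatives to a pair
  \<open>(w, _)\<close> of representatives at the same distance.\<close>

lemma unlabeled_edist_fixed_representative:
  assumes G: "G \<in> unlabeled_graphs V" "w \<in> G" and G': "G' \<in> unlabeled_graphs V"
  shows "unlabeled_edist V G G' = (INF w'\<in>G'. labeled_dist V w w')"
proof (rule antisym)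
  show "unlabeled_edist V G G' \<le> (INF w'\<in>G'. labeled_dist V w w')"
    using G by (auto intro!: INF_greatest unlabeled_edist_le)
  have "(INF w'\<in>G'. labeled_dist V w w') \<le> labeled_dist V w1 w1'" if w1: "w1 \<in> G" "w1' \<in> G'" for w1 w1'
  proof -
    have std: "w \<in> finite_norm_standard_graphs V" "w1' \<in> finite_norm_standard_graphs V"
      using G G' w1 unlabeled_graphs_finite_norm_standard by blast+
    then have "w \<in> labeled_graphs V"
      by (simp add: finite_norm_standard_graphs_def standard_graphs_def)
    then obtain f where f: "bij_betw f V V" and w: "w = push V f w1"
      using unlabeled_graphs_isomorphic[OF G(1) w1(1) G(2)] isomorphic_graphs_iff_push by blast
    then have inj: "inj_on f V" "f ` V \<subseteq> V"
      by (auto simp: bij_betw_def)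
    have "push V f w1' \<in> finite_norm_standard_graphs V"
      using std(2) inj
      by (auto simp: finite_norm_standard_graphs_def push_in_finite_norm_graphs push_standard)
    moreover have "isomorphic_graphs V w1' (push V f w1')"
      using f push_in_labeled_graphs isomorphic_graphs_iff_push by blast
    ultimately have "push V f w1' \<in> G'"
      using unlabeled_graphs_closed G' w1(2) by blast
    moreover have "labeled_dist V w (push V f w1') = labeled_dist V w1 w1'"
      unfolding w by (rule labeled_dist_push[OF inj])
    ultimately show ?thesis
      by (metis INF_lower)
  qed
  then show "(INF w'\<in>G'. labeled_dist V w w') \<le> unlabeled_edist V G G'"
    unfolding unlabeled_edist_def by (auto intro!: INF_greatest)
qed

lemma unlabeled_edist_less_representative:
  assumes "G \<in> unlabeled_graphs V" "w \<in> G" "G' \<in> unlabeled_graphs V" "unlabeled_edist V G G' < r"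
  obtains w' where "w' \<in> G'" "labeled_dist V w w' < r"
  using assms unfolding unlabeled_edist_fixed_representative[OF assms(1-3)] INF_less_iff by blast

lemma unlabeled_edist_finite:
  assumes "G \<in> unlabeled_graphs V" "G' \<in> unlabeled_graphs V"
  shows "unlabeled_edist V G G' < \<infinity>"
proof -
  obtain w w' where w: "w \<in> G" "w' \<in> G'"
    using assms unlabeled_graphs_nonempty by blast
  have "unlabeled_edist V G G' \<le> graph_norm V w + graph_norm V w'"
    using order_trans[OF unlabeled_edist_le[OF w] labeled_dist_le_norms] .
  also have "\<dots> < \<infinity>"
    using assms w unlabeled_graphs_finite_norm_standard[of _ V]
    by (auto simp: finite_norm_standard_graphs_def finite_norm_graphs_def)
  finally show ?thesis .
qed

lemma ennreal_unlabeled_dist: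
  assumes "G \<in> unlabeled_graphs V" "G' \<in> unlabeled_graphs V"
  shows "ennreal (unlabeled_dist V G G') = unlabeled_edist V G G'"
  using unlabeled_edist_finite[OF assms] by (simp add: unlabeled_dist_eq)

lemma unlabeled_dist_less_iff:
  assumes "G \<in> unlabeled_graphs V" "G' \<in> unlabeled_graphs V" "0 \<le> r"
  shows "unlabeled_dist V G G' < r \<longleftrightarrow> unlabeled_edist V G G' < ennreal r"
  unfolding ennreal_unlabeled_dist[OF assms(1,2), symmetric]
  using assms(3) by (simp add: ennreal_less_iff unlabeled_dist_eq)

lemma unlabeled_edist_triangle:
  assumes "G \<in> unlabeled_graphs V" "G' \<in> unlabeled_graphs V" "G'' \<in> unlabeled_graphs V"
  shows "unlabeled_edist V G G'' \<le> unlabeled_edist V G G' + unlabeled_edist V G' G''"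
proof -
  obtain w' where w': "w' \<in> G'"
    using assms unlabeled_graphs_nonempty by blast
  show ?thesis
  proof (rule ennreal_le_epsilon)
    fix r :: real
    assume r: "0 < r"
    have "unlabeled_edist V G' H < unlabeled_edist V G' H + ennreal (r/2)" if "H \<in> unlabeled_graphs V" for H
      using unlabeled_edist_finite[OF assms(2) that] r
        ennreal_add_left_cancel_less[of "unlabeled_edist V G' H" 0 "ennreal (r/2)"]
      by simp
    then obtain w w'' where w: "w \<in> G" "labeled_dist V w' w < unlabeled_edist V G' G + ennreal (r/2)"
      and w'': "w'' \<in> G''" "labeled_dist V w' w'' < unlabeled_edist V G' G'' + ennreal (r/2)"
      using unlabeled_edist_less_representative[OF assms(2) w'] assms(1,3) by metis
    have "unlabeled_edist V G G'' \<le> labeled_dist V w w''"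
      using w(1) w''(1) by (rule unlabeled_edist_le)
    also have "\<dots> \<le> labeled_dist V w' w + labeled_dist V w' w''"
      using labeled_dist_triangle[of V w w'' w'] by (simp add: labeled_dist_commute)
    also have "\<dots> \<le> (unlabeled_edist V G' G + ennreal (r/2)) + (unlabeled_edist V G' G'' + ennreal (r/2))"
      using w(2) w''(2) by (intro add_mono less_imp_le)
    also have "\<dots> = unlabeled_edist V G G' + unlabeled_edist V G' G'' + (ennreal (r/2) + ennreal (r/2))"
      by (simp add: unlabeled_edist_commute[of V G G'] ac_simps)
    also have "ennreal (r/2) + ennreal (r/2) = ennreal r"
      using r by (subst ennreal_plus[symmetric]) auto
    finally show "unlabeled_edist V G G'' \<le> unlabeled_edist V G G' + unlabeled_edist V G' G'' + ennreal r" .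
  qed
qed

lemma unlabeled_edist_zero_imp_eq:
  assumes V: "countable V" and G: "G \<in> unlabeled_graphs V" and G': "G' \<in> unlabeled_graphs V"
    and zero: "unlabeled_edist V G G' = 0"
  shows "G = G'"
proof -
  obtain w w' where w: "w \<in> G" "w' \<in> G'"
    using G G' unlabeled_graphs_nonempty by blast
  have std: "w \<in> finite_norm_standard_graphs V" "w' \<in> finite_norm_standard_graphs V"
    using G G' w unlabeled_graphs_finite_norm_standard by blast+
  have "\<exists>f. bij_betw f V V \<and> (\<forall>e\<in>edges V. \<bar>w e - w' (f ` e)\<bar> \<le> inverse (real (Suc n)))" for n
  proof -
    have "unlabeled_edist V G G' < ennreal (inverse (real (Suc n)))"
      unfolding zero by simp
    then obtain w1 where w1: "w1 \<in> G'" "labeled_dist V w w1 < ennreal (inverse (real (Suc n)))"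
      by (rule unlabeled_edist_less_representative[OF G w(1) G'])
    obtain f where f: "bij_betw f V V" "\<forall>e\<in>edges V. w1 e = w' (f ` e)"
      using unlabeled_graphs_isomorphic[OF G' w1(1) w(2)] isomorphic_graphs_iff_edges by blast
    have "\<bar>w e - w' (f ` e)\<bar> \<le> inverse (real (Suc n))" if "e \<in> edges V" for e
    proof -
      have "ennreal \<bar>w e - w1 e\<bar> \<le> ennreal (inverse (real (Suc n)))"
        using order_trans[OF abs_diff_le_labeled_dist[OF that] less_imp_le[OF w1(2)]] .
      then show ?thesis
        using f(2) that by (subst (asm) ennreal_le_iff) auto
    qed
    with f(1) show ?thesis by blast
  qed
  then obtain f where "\<And>n. bij_betw (f n) V V"
    "\<And>n e. e \<in> edges V \<Longrightarrow> \<bar>w e - w' (f n ` e)\<bar> \<le> inverse (real (Suc n))"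
    by metis
  then have "isomorphic_graphs V w w'"
    by (rule isomorphic_graphs_of_almost_isomorphisms[OF V std _ _ LIMSEQ_inverse_real_of_nat])
  then show ?thesis
    using unlabeled_graphs_eq G G' w by blast
qed

lemma Metric_space_unlabeled_graphs:
  assumes "countable V"
  shows "Metric_space (unlabeled_graphs V) (unlabeled_dist V)"
proof
  fix G G' G''
  show "0 \<le> unlabeled_dist V G G'"
    by (simp add: unlabeled_dist_eq)
  show "unlabeled_dist V G G' = unlabeled_dist V G' G"
    unfolding unlabeled_dist_eq by (subst unlabeled_edist_commute) rule
  assume G: "G \<in> unlabeled_graphs V" and G': "G' \<in> unlabeled_graphs V"
  have "unlabeled_edist V G G = 0"
  proof -
    obtain w where "w \<in> G"
      using G unlabeled_graphs_nonempty by blast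
    then show ?thesis
      using unlabeled_edist_le[of w G w G V] by (simp add: labeled_dist_self)
  qed
  moreover have "unlabeled_dist V G G' = 0 \<longleftrightarrow> unlabeled_edist V G G' = 0"
    using ennreal_unlabeled_dist[OF G G'] by (auto simp: unlabeled_dist_eq)
  ultimately show "unlabeled_dist V G G' = 0 \<longleftrightarrow> G = G'"
    using unlabeled_edist_zero_imp_eq[OF assms G G'] by auto
  assume G'': "G'' \<in> unlabeled_graphs V"
  have "ennreal (unlabeled_dist V G G'') \<le> ennreal (unlabeled_dist V G G') + ennreal (unlabeled_dist V G' G'')"
    using unlabeled_edist_triangle[OF G G' G''] by (simp add: ennreal_unlabeled_dist G G' G'')
  also have "\<dots> = ennreal (unlabeled_dist V G G' + unlabeled_dist V G' G'')"
    by (simp add: unlabeled_dist_eq)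
  finally show "unlabeled_dist V G G'' \<le> unlabeled_dist V G G' + unlabeled_dist V G' G''"
    by (subst (asm) ennreal_le_iff) (simp_all add: unlabeled_dist_eq)
qed

section \<open>Completeness\<close>

lemma countable_infinite_shift:
  assumes "countable V" "infinite V"
  obtains i where "inj_on i V" "i ` V \<subseteq> V" "infinite (V - i ` V)"
proof -
  define h where "h = to_nat_on V"
  have h: "bij_betw h V UNIV"
    unfolding h_def using assms by (rule to_nat_on_infinite)
  define k where "k = inv_into V h"
  have k: "bij_betw k UNIV V"
    unfolding k_def using h by (rule bij_betw_inv_into)
  then have inj_k: "inj k" and range_k: "range k = V"
    by (auto simp: bij_betw_def)
  \<comment> \<open>Number the vertices by \<open>h\<close> and double the number; the odd-numbered vertices stay free.\<close>
  have "inj_on (\<lambda>v. k (2 * h v)) V"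
  proof (rule inj_onI)
    fix u v
    assume "u \<in> V" "v \<in> V" "k (2 * h u) = k (2 * h v)"
    moreover from this have "2 * h u = 2 * h v"
      using inj_k by (simp add: inj_eq)
    ultimately show "u = v"
      using h by (auto simp: bij_betw_def dest: inj_onD)
  qed
  moreover have "(\<lambda>v. k (2 * h v)) ` V \<subseteq> V"
    using range_k by auto
  moreover have "range (\<lambda>n. k (2 * n + 1)) \<subseteq> V - (\<lambda>v. k (2 * h v)) ` V"
  proof safe
    fix n v
    assume "k (2 * n + 1) = k (2 * h v)"
    then have "2 * n + 1 = 2 * h v"
      using inj_k by (simp add: inj_eq)
    then show False by presburger
  qed (use range_k in auto)
  moreover have "infinite (range (\<lambda>n. k (2 * n + 1)))"
    using inj_k by (intro range_inj_infinite injI) (simp add: inj_eq)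
  ultimately show thesis
    using that finite_subset by blast
qed

text \<open>The labeled limit \<open>l\<close> of suitable representatives need not be standard. Moving everything along
  one injection with co-infinite range repairs this and leaves the distances and the classes \<open>G n\<close>
  as they are.\<close>

lemma geometric_Cauchy_unlabeled_limit:
  assumes V: "countable V" "infinite V"
    and G: "\<And>n. G n \<in> unlabeled_graphs V"
    and step: "\<And>n. unlabeled_edist V (G n) (G (Suc n)) < ennreal ((1/2)^n)"
  shows "\<exists>L\<in>unlabeled_graphs V. \<forall>n. unlabeled_edist V (G n) L \<le> ennreal (2 * (1/2)^n)"
proof -
  have "\<exists>w. \<forall>n. w n \<in> G n \<and> labeled_dist V (w n) (w (Suc n)) < ennreal ((1/2)^n)"
  proof (rule dependent_nat_choice)
    show "\<exists>w. w \<in> G 0"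
      using G unlabeled_graphs_nonempty by blast
    show "\<exists>w'. w' \<in> G (Suc n) \<and> labeled_dist V w w' < ennreal ((1/2)^n)" if "w \<in> G n" for w n
      using unlabeled_edist_less_representative[OF G that G step] by metis
  qed
  then obtain w where wG: "\<And>n. w n \<in> G n"
    and w_step: "\<And>n. labeled_dist V (w n) (w (Suc n)) < ennreal ((1/2)^n)"
    by blast
  have std: "w n \<in> finite_norm_graphs V" "w n \<in> standard_graphs V" for n
    using unlabeled_graphs_finite_norm_standard[OF G wG] by (auto simp: finite_norm_standard_graphs_def)
  obtain l where l: "l \<in> finite_norm_graphs V"
    "\<And>n. labeled_dist V (w n) l \<le> ennreal (2 * (1/2)^n)"
    using geometric_Cauchy_labeled_limit[of w V] std(1) w_step by (meson less_imp_le)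
  obtain i where i: "inj_on i V" "i ` V \<subseteq> V" "infinite (V - i ` V)"
    using countable_infinite_shift[OF V] by metis
  define L where "L = isomorphism_rel V `` {push V i l}"
  have pl: "push V i l \<in> finite_norm_standard_graphs V"
    using l(1) i by (simp add: finite_norm_standard_graphs_def push_in_finite_norm_graphs push_coinfinite_standard)
  then have L: "L \<in> unlabeled_graphs V" "push V i l \<in> L"
    unfolding L_def using isomorphism_class_in_unlabeled_graphs[OF pl] by (auto intro: isomorphic_graphs_refl)
  have "unlabeled_edist V (G n) L \<le> ennreal (2 * (1/2)^n)" for n
  proof -
    have "push V i (w n) \<in> finite_norm_standard_graphs V"
      using std i by (simp add: finite_norm_standard_graphs_def push_in_finite_norm_graphs push_standard)
    then have "push V i (w n) \<in> G n"
      using unlabeled_graphs_closed[OF G wG] isomorphic_graphs_push[OF V(1) i(1,2) std(2)] by blast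
    then have "unlabeled_edist V (G n) L \<le> labeled_dist V (push V i (w n)) (push V i l)"
      using L(2) by (rule unlabeled_edist_le)
    also have "\<dots> = labeled_dist V (w n) l"
      by (rule labeled_dist_push[OF i(1,2)])
    finally show ?thesis
      using l(2) by (rule order_trans)
  qed
  with L(1) show ?thesis by blast
qed

theorem theorem9:
  fixes V :: "'v set"
  assumes "countable V" and "infinite V"
  shows "Metric_space (unlabeled_graphs V) (unlabeled_dist V) \<and>
         Metric_space.mcomplete (unlabeled_graphs V) (unlabeled_dist V)"
proof
  show M: "Metric_space (unlabeled_graphs V) (unlabeled_dist V)"
    using assms(1) by (rule Metric_space_unlabeled_graphs)
  interpret Metric_space "unlabeled_graphs V" "unlabeled_dist V"
    by (fact M)
  show mcomplete
    unfolding mcomplete_def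
  proof (intro allI impI)
    fix \<sigma>
    assume \<sigma>: "MCauchy \<sigma>"
    then have \<sigma>_in: "\<sigma> n \<in> unlabeled_graphs V" for n
      by (auto simp: MCauchy_def)
    have cauchy: "\<exists>N. \<forall>m\<ge>N. \<forall>m'\<ge>N. unlabeled_dist V (\<sigma> m) (\<sigma> m') < (1/2)^n" for n
      using \<sigma> unfolding MCauchy_def by simp
    have "\<exists>r. \<forall>n. (\<forall>m\<ge>r n. \<forall>m'\<ge>r n. unlabeled_dist V (\<sigma> m) (\<sigma> m') < (1/2)^n) \<and> r n < r (Suc n)"
    proof (rule dependent_nat_choice)
      fix k n :: nat
      obtain N where N: "\<forall>m\<ge>N. \<forall>m'\<ge>N. unlabeled_dist V (\<sigma> m) (\<sigma> m') < (1/2)^Suc n"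
        using cauchy by blast
      show "\<exists>k'. (\<forall>m\<ge>k'. \<forall>m'\<ge>k'. unlabeled_dist V (\<sigma> m) (\<sigma> m') < (1/2)^Suc n) \<and> k < k'"
        by (rule exI[of _ "max N (Suc k)"]) (use N in auto)
    qed (rule cauchy)
    then obtain r where r: "\<And>n m m'. r n \<le> m \<Longrightarrow> r n \<le> m' \<Longrightarrow> unlabeled_dist V (\<sigma> m) (\<sigma> m') < (1/2)^n"
      and r_less: "\<And>n. r n < r (Suc n)"
      by blast
    have "strict_mono r"
      using r_less by (simp add: strict_mono_Suc_iff)
    have "unlabeled_edist V (\<sigma> (r n)) (\<sigma> (r (Suc n))) < ennreal ((1/2)^n)" for n
      using r[of n "r n" "r (Suc n)"] r_less[of n]
      by (simp add: unlabeled_dist_less_iff \<sigma>_in)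
    then obtain L where L: "L \<in> unlabeled_graphs V"
      "\<And>n. unlabeled_edist V (\<sigma> (r n)) L \<le> ennreal (2 * (1/2)^n)"
      using geometric_Cauchy_unlabeled_limit[OF assms, of "\<lambda>n. \<sigma> (r n)"] \<sigma>_in by blast
    have bound: "unlabeled_dist V (\<sigma> (r n)) L \<le> 2 * (1/2)^n" for n
      using L(2)[of n] unfolding ennreal_unlabeled_dist[OF \<sigma>_in L(1), symmetric]
      by (subst (asm) ennreal_le_iff) auto
    have "(\<lambda>n. (1/2)^n :: real) \<longlonglongrightarrow> 0"
      by (rule LIMSEQ_realpow_zero) auto
    from tendsto_mult_left[OF this, of 2] have lim: "(\<lambda>n. 2 * (1/2)^n :: real) \<longlonglongrightarrow> 0"
      by simp
    have "(\<lambda>n. unlabeled_dist V (\<sigma> (r n)) L) \<longlonglongrightarrow> 0"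
      by (rule tendsto_sandwich[OF always_eventually always_eventually tendsto_const lim])
        (intro allI nonneg bound)+
    then have "limitin mtopology (\<sigma> \<circ> r) L sequentially"
      using L(1) \<sigma>_in by (simp add: limitin_metric_dist_null o_def)
    then show "\<exists>x. limitin mtopology \<sigma> x sequentially"
      using MCauchy_convergent_subsequence[OF \<sigma> \<open>strict_mono r\<close>] by blast
  qed
qed

end
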